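(* Let $m \geq 2$ be an integer, let $k$ be a field containing a primitive $m$-th root of unity, and let $f = X^{\nu}$ be a fundamental invariant of the standard representation of the cyclic group $G$ of order $m$ over $k$. (i) If $\deg X^{\nu} + \sigma(\nu) = m+1$, then $\sigma(\nu) \leq 2$, except when $m = 6$ and $f = X_1 X_2^0 X_3 X_4^2 = X_1 X_3 X_4^2$ or $f = X_2^2 X_3 X_5$. (ii) If $m \geq 3$, $m \neq 6$, and $\deg X^{\nu} + \sigma(\nu) = m+1$, then the monomial $f$ contains a variable $X_i$ of degree $\nu_i \geq m-2$. (iii) If $m \geq 7$ and $f$ contains $s \geq 3$ different variables (i.e. $\sigma(\nu) = s \geq 3$), then its total degree is bounded by $\deg f \leq m - \sigma(\nu)$.
   Context: Let $\varepsilon \in k$ be a fixed primitive $m$-th root of unity and $A$ a fixed generator of the cyclic group $G$ of order $m$. The standard representation is the action of $G$ on the polynomial ring $k[X_1,\ldots,X_{m-1}]$ by $k$-algebra automorphisms with $A \cdot X_i = \varepsilon^{i} X_i$ for $i = 1,\ldots,m-1$. For $\nu = (\nu_1,\ldots,\nu_{m-1}) \in \mathbb{N}^{m-1}$ ($\mathbb{N} = \{0,1,2,\ldots\}$) write $X^{\nu} = X_1^{\nu_1}\cdots X_{m-1}^{\nu_{m-1}}$; $\deg X^{\nu} = \nu_1 + \cdots + \nu_{m-1}$ and $\sigma(\nu) = \#\{i : \nu_i \neq 0\}$ is the number of different variables occurring in $X^\nu$. A fundamental invariant is a monomial $X^{\nu}$ for which $\nu$ is an indecomposable solution of $\nu_1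 + 2\nu_2 + \cdots + (m-1)\nu_{m-1} \equiv 0 \pmod m$, that is, nonzero and minimal (componentwise) among the nonzero solutions in $\mathbb{N}^{m-1}$; these monomials form the minimal system of generators of the invariant algebra consisting of monomials. *)

theory Defs
  imports
    Complex_Main
    "HOL-Library.Poly_Mapping"
    "HOL-Number_Theory.Cong"
    "HOL-Algebra.Group_Action"
    "HOL-Algebra.Generated_Groups"
begin

text \<open>
  Exponent vectors are finitely supported functions \<^typ>\<open>nat \<Rightarrow>\<^sub>0 nat\<close>; multiplication on
  \<^typ>\<open>(nat \<Rightarrow>\<^sub>0 nat) \<Rightarrow>\<^sub>0 'k\<close> is convolution, so this type is the polynomial ring over \<^typ>\<open>'k\<close> in
  variables indexed by all of \<^typ>\<open>nat\<close>. The ring in the variables with indices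
  1, ..., m - 1 is the subset \<open>polys m\<close>.
\<close>

type_synonym 'k mpoly = "(nat \<Rightarrow>\<^sub>0 nat) \<Rightarrow>\<^sub>0 'k"

definition const :: "'k::field \<Rightarrow> 'k mpoly"
  where "const c = Poly_Mapping.single 0 c"

definition X :: "nat \<Rightarrow> 'k::field mpoly"
  where "X i = Poly_Mapping.single (Poly_Mapping.single i 1) 1"

definition monomial :: "(nat \<Rightarrow>\<^sub>0 nat) \<Rightarrow> 'k::field mpoly"
  where "monomial \<nu> = (\<Prod>i\<in>Poly_Mapping.keys \<nu>. X i ^ Poly_Mapping.lookup \<nu> i)"

definition mdeg :: "(nat \<Rightarrow>\<^sub>0 nat) \<Rightarrow> nat"
  where "mdeg \<nu> = (\<Sum>i\<in>Poly_Mapping.keys \<nu>. Poly_Mapping.lookup \<nu> i)"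

definition num_vars :: "(nat \<Rightarrow>\<^sub>0 nat) \<Rightarrow> nat"
  where "num_vars \<nu> = card {i. Poly_Mapping.lookup \<nu> i \<noteq> 0}"

definition exponents :: "nat \<Rightarrow> (nat \<Rightarrow>\<^sub>0 nat) set"
  where "exponents m = {\<nu>. Poly_Mapping.keys \<nu> \<subseteq> {1..m-1}}"

definition polys :: "nat \<Rightarrow> 'k::field mpoly set"
  where "polys m = {p. Poly_Mapping.keys p \<subseteq> exponents m}"

definition primitive_root_of_unity :: "nat \<Rightarrow> 'k::field \<Rightarrow> bool"
  where "primitive_root_of_unity m \<epsilon> \<longleftrightarrow> m > 0 \<and> \<epsilon> ^ m = 1 \<and> (\<forall>j. 0 < j \<and> j < m \<longrightarrow> \<epsilon> ^ j \<noteq> 1)"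

text \<open>
  Bijectivity of each \<open>\<phi> g\<close> on \<open>polys m\<close> and compatibility with the group operation are part of
  \<^const>\<open>group_action\<close>.
\<close>

locale standard_representation =
  group_action G "polys m :: 'k::field mpoly set" \<phi>
  for m :: nat and G :: "('g, 'h) monoid_scheme" (structure)
    and \<phi> :: "'g \<Rightarrow> 'k::field mpoly \<Rightarrow> 'k mpoly" +
  fixes \<epsilon> :: "'k::field" and A :: 'g
  assumes primitive: "primitive_root_of_unity m \<epsilon>"
    and order_G: "order G = m"
    and A_in: "A \<in> carrier G"
    and generated: "generate G {A} = carrier G"
    and act_add: "\<And>g p q. g \<in> carrier G \<Longrightarrow> p \<in> polys m \<Longrightarrow> q \<in> polys m \<Longrightarrow>
      \<phi> g (p + q) = \<phi> g p + \<phi> g q"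
    and act_mult: "\<And>g p q. g \<in> carrier G \<Longrightarrow> p \<in> polys m \<Longrightarrow> q \<in> polys m \<Longrightarrow>
      \<phi> g (p * q) = \<phi> g p * \<phi> g q"
    and act_const: "\<And>g c. g \<in> carrier G \<Longrightarrow> \<phi> g (const c) = const c"
    and act_X: "\<And>i. i \<in> {1..m-1} \<Longrightarrow> \<phi> A (X i) = const (\<epsilon> ^ i) * X i"

definition weight :: "(nat \<Rightarrow>\<^sub>0 nat) \<Rightarrow> nat"
  where "weight \<nu> = (\<Sum>i\<in>Poly_Mapping.keys \<nu>. i * Poly_Mapping.lookup \<nu> i)"

definition solution :: "nat \<Rightarrow> (nat \<Rightarrow>\<^sub>0 nat) \<Rightarrow> bool"
  where "solution m \<nu> \<longleftrightarrow> \<nu> \<in> exponents m \<and> [weight \<nu> = 0] (mod m)"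

definition indecomposable_solution :: "nat \<Rightarrow> (nat \<Rightarrow>\<^sub>0 nat) \<Rightarrow> bool"
  where "indecomposable_solution m \<nu> \<longleftrightarrow>
    solution m \<nu> \<and> \<nu> \<noteq> 0 \<and>
    (\<forall>\<mu>. solution m \<mu> \<and> \<mu> \<noteq> 0 \<and> (\<forall>i. Poly_Mapping.lookup \<mu> i \<le> Poly_Mapping.lookup \<nu> i) \<longrightarrow> \<mu> = \<nu>)"

definition fundamental_invariant :: "nat \<Rightarrow> 'k::field mpoly \<Rightarrow> bool"
  where "fundamental_invariant m f \<longleftrightarrow> (\<exists>\<nu>. indecomposable_solution m \<nu> \<and> f = monomial \<nu>)"

lemma X_power: "(X i :: 'k::field mpoly) ^ n = Poly_Mapping.single (Poly_Mapping.single i n) 1"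
  by (induction n) (simp_all add: X_def mult_single single_add[symmetric])

lemma prod_single_one:
  "finite S \<Longrightarrow> (\<Prod>i\<in>S. Poly_Mapping.single (g i :: nat \<Rightarrow>\<^sub>0 nat) (1 :: 'k::field))
     = Poly_Mapping.single (\<Sum>i\<in>S. g i) 1"
  by (induction S rule: finite_induct) (simp_all add: mult_single)

lemma monomial_eq_single: "(monomial \<nu> :: 'k::field mpoly) = Poly_Mapping.single \<nu> 1"
proof -
  have "(\<Sum>i\<in>Poly_Mapping.keys \<nu>. Poly_Mapping.single i (Poly_Mapping.lookup \<nu> i)) = \<nu>"
    by (rule poly_mapping_eqI)
      (auto simp: lookup_sum lookup_single when_def in_keys_iff sum.delta')
  then show ?thesis
    by (simp add: monomial_def X_power prod_single_one)
qed

lemma monomial_inject: "(monomial \<mu> :: 'k::field mpoly) = monomial \<nu> \<longleftrightarrow> \<mu> = \<nu>"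
  by (metis lookup_single_eq lookup_single_not_eq monomial_eq_single zero_neq_one)

lemma polys_mult:
  assumes "p \<in> polys m" "q \<in> polys m"
  shows "p * q \<in> polys m"
proof -
  have "a + b \<in> exponents m" if "a \<in> exponents m" "b \<in> exponents m" for a b
    using that keys_add[of a b] by (auto simp: exponents_def)
  then show ?thesis
    using assms keys_mult[of p q] unfolding polys_def by blast
qed

lemma const_in_polys: "const c \<in> polys m"
  by (auto simp: const_def polys_def exponents_def)

lemma X_in_polys: "i \<in> {1..m-1} \<Longrightarrow> X i \<in> polys m"
  by (auto simp: X_def polys_def exponents_def)

lemma const_mult: "const a * const b = const (a * b)"
  by (simp add: const_def mult_single)

lemma const_one: "const 1 = 1"
  by (simp add: const_def)

lemma X_power_in_polys: "i \<in> {1..m-1} \<Longrightarrow> X i ^ n \<in> polys m"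
  by (induction n) (auto simp: polys_mult X_in_polys const_in_polys simp flip: const_one)

lemma prod_in_polys:
  "finite S \<Longrightarrow> S \<subseteq> {1..m-1} \<Longrightarrow> (\<Prod>i\<in>S. X i ^ h i) \<in> polys m"
  by (induction S rule: finite_induct)
    (auto intro!: polys_mult X_power_in_polys simp: const_in_polys simp flip: const_one)

lemma primitive_root_power_eq_one:
  assumes "primitive_root_of_unity m \<epsilon>"
  shows "\<epsilon> ^ n = 1 \<longleftrightarrow> m dvd n"
proof -
  have "\<epsilon> ^ n = \<epsilon> ^ (m * (n div m) + n mod m)" by simp
  also have "\<dots> = \<epsilon> ^ (n mod m)"
    using assms unfolding power_add power_mult by (simp add: primitive_root_of_unity_def)
  finally show ?thesis
    using assms by (auto simp: primitive_root_of_unity_def dvd_eq_mod_eq_0)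
qed

context standard_representation
begin

lemma act_X_power:
  "i \<in> {1..m-1} \<Longrightarrow> \<phi> A (X i ^ n) = const (\<epsilon> ^ (i * n)) * X i ^ n"
proof (induction n)
  case 0
  then show ?case using act_const[OF A_in, of 1] by (simp add: const_one)
next
  case (Suc n)
  have "\<phi> A (X i ^ Suc n) = (const (\<epsilon> ^ i) * const (\<epsilon> ^ (i * n))) * (X i * X i ^ n)"
    using Suc act_mult[OF A_in X_in_polys X_power_in_polys, of i i n] act_X[of i]
    by (simp add: mult_ac)
  then show ?case by (simp add: const_mult power_add)
qed

lemma act_prod:
  "finite S \<Longrightarrow> S \<subseteq> {1..m-1} \<Longrightarrow>
    \<phi> A (\<Prod>i\<in>S. X i ^ h i) = const (\<epsilon> ^ (\<Sum>i\<in>S. i * h i)) * (\<Prod>i\<in>S. X i ^ h i)"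
proof (induction S rule: finite_induct)
  case empty
  then show ?case using act_const[OF A_in, of 1] by (simp add: const_one)
next
  case (insert j S)
  have "\<phi> A (X j ^ h j * (\<Prod>i\<in>S. X i ^ h i)) = \<phi> A (X j ^ h j) * \<phi> A (\<Prod>i\<in>S. X i ^ h i)"
    using insert by (intro act_mult A_in X_power_in_polys prod_in_polys) auto
  also have "\<dots> = (const (\<epsilon> ^ (j * h j)) * const (\<epsilon> ^ (\<Sum>i\<in>S. i * h i)))
      * (X j ^ h j * (\<Prod>i\<in>S. X i ^ h i))"
    using insert act_X_power[of j "h j"] by (simp add: mult_ac)
  finally show ?case using insert by (simp add: const_mult power_add)
qed

text \<open>The congruence in \<^const>\<open>solution\<close> says exactly that the monomial is \<open>G\<close>-invariant.\<close>

lemma solution_iff_invariant: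
  assumes "\<nu> \<in> exponents m"
  shows "solution m \<nu> \<longleftrightarrow> (\<forall>g\<in>carrier G. \<phi> g (monomial \<nu>) = monomial \<nu>)"
proof -
  have in_polys: "monomial \<nu> \<in> polys m"
    using assms by (auto simp: monomial_def exponents_def intro!: prod_in_polys)
  have "\<phi> A (monomial \<nu>) = const (\<epsilon> ^ weight \<nu>) * monomial \<nu>"
    using act_prod[of "Poly_Mapping.keys \<nu>" "Poly_Mapping.lookup \<nu>"] assms
    by (simp add: monomial_def weight_def exponents_def)
  also have "\<dots> = Poly_Mapping.single \<nu> (\<epsilon> ^ weight \<nu>)"
    by (simp add: const_def monomial_eq_single mult_single)
  finally have "\<phi> A (monomial \<nu>) = monomial \<nu> \<longleftrightarrow> \<epsilon> ^ weight \<nu> = 1"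
    by (metis lookup_single_eq monomial_eq_single)
  then have fixed_A: "\<phi> A (monomial \<nu>) = monomial \<nu> \<longleftrightarrow> solution m \<nu>"
    using assms primitive_root_power_eq_one[OF primitive, of "weight \<nu>"]
    by (simp add: solution_def cong_0_iff)
  have "carrier G \<subseteq> stabilizer G \<phi> (monomial \<nu>)" if "\<phi> A (monomial \<nu>) = monomial \<nu>"
  proof -
    interpret group_hom G "BijGroup (polys m)" \<phi> by (rule group_hom)
    have "generate G {A} \<subseteq> stabilizer G \<phi> (monomial \<nu>)"
      using that A_in stabilizer_subgroup[OF in_polys]
      by (intro G.generate_subgroup_incl) (auto simp: stabilizer_def)
    then show ?thesis by (simp add: generated)
  qed
  then show ?thesis
    using fixed_A A_in by (auto simp: stabilizer_def)
qed

end

end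

theory Submission
  imports Defs "HOL-Library.Multiset"
begin

text \<open>
  A fundamental invariant is a minimal zero-sum sequence \<open>S\<close> of nonzero residues modulo \<open>m\<close>, in which
  \<open>i\<close> occurs \<open>\<nu>\<^sub>i\<close> times. By Scherk's theorem, the number of subset sums of a zero-sum-free sequence is
  superadditive (up to the common empty sum) under concatenation. A zero-sum-free set of \<open>n \<ge> 4\<close>
  residues contains a triple with all 8 subset sums distinct, so by splitting off such triples it has
  at least \<open>2n + 1\<close> subset sums, the empty one included. If an element of \<open>S\<close> is repeated,
  remove one copy: the support and the remaining terms together have at most \<open>m\<close> subset sums, which
  gives \<open>deg + \<sigma> \<le> m\<close> for \<open>\<sigma> \<ge> 4\<close>. If no element is repeated, then \<open>2\<sigma> \<le> m\<close>
  because \<open>S\<close> contains no pair \<open>{x, -x}\<close>. For \<open>\<sigma> = 3\<close> the only supports with too few subset sums are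
  \<open>{m/2, a, a + m/2}\<close>, for which \<open>deg \<le> m/2 + 1\<close>; this leaves the exceptions at \<open>m = 6\<close>.
\<close>

section \<open>Zero-sum sequences modulo \<open>m\<close>\<close>

text \<open>Sums are stored as representatives in \<open>{0..<m}\<close>, so that cardinalities
  count residue classes.\<close>

definition subsums :: "int \<Rightarrow> int multiset \<Rightarrow> int set"
  where "subsums m S = (\<lambda>A. sum_mset A mod m) ` {A. A \<subseteq># S}"

definition zero_sum_free :: "int \<Rightarrow> int multiset \<Rightarrow> bool"
  where "zero_sum_free m S \<longleftrightarrow> (\<forall>A. A \<subseteq># S \<longrightarrow> A \<noteq> {#} \<longrightarrow> \<not> m dvd sum_mset A)"

definition minimal_zero_sum :: "int \<Rightarrow> int multiset \<Rightarrow> bool"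
  where "minimal_zero_sum m S \<longleftrightarrow>
    m dvd sum_mset S \<and> S \<noteq> {#} \<and> (\<forall>A. A \<subset># S \<longrightarrow> A \<noteq> {#} \<longrightarrow> \<not> m dvd sum_mset A)"

definition sumset_mod :: "int \<Rightarrow> int set \<Rightarrow> int set \<Rightarrow> int set"
  where "sumset_mod m A B = (\<lambda>(a, b). (a + b) mod m) ` (A \<times> B)"

section \<open>Scherk's theorem for cyclic groups\<close>

text \<open>Repeated shifts of 0 reach every multiple of \<open>b\<close>, and
  \<open>(m - 1) * b\<close> is congruent to \<open>- b\<close>.\<close>

lemma shift_closed_contains_negative:
  fixes m :: int
  assumes "m > 0" "0 \<in> A" "\<And>a. a \<in> A \<Longrightarrow> (a + b) mod m \<in> A"
  shows "(- b) mod m \<in> A"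
proof -
  have "(int k * b) mod m \<in> A" for k
  proof (induction k)
    case (Suc k)
    have "(int (Suc k) * b) mod m = (((int k * b) mod m) + b) mod m"
      by (simp add: algebra_simps mod_simps)
    then show ?case using assms(3)[OF Suc] by simp
  qed (use assms in simp)
  from this[of "nat (m - 1)"] have "((m - 1) * b) mod m \<in> A" using \<open>m > 0\<close> by simp
  moreover have "((m - 1) * b) mod m = (- b) mod m"
    by (simp add: algebra_simps mod_diff_left_eq[symmetric] flip: mod_diff_eq)
  ultimately show ?thesis by simp
qed

text \<open>The induction on the cardinality of \<open>B\<close> replaces \<open>(A, B)\<close> by
  \<open>(A \<union> (e + B), {b \<in> B. e + b \<in> A})\<close>, which preserves the unique representation of 0.\<close>

lemma scherk:
  fixes m :: int
  assumes "m > 0" "A \<subseteq> {0..<m}" "B \<subseteq> {0..<m}" "0 \<in> A" "0 \<in> B"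
    and "\<And>a b. a \<in> A \<Longrightarrow> b \<in> B \<Longrightarrow> m dvd a + b \<Longrightarrow> a = 0 \<and> b = 0"
  shows "card A + card B \<le> card (sumset_mod m A B) + 1"
  using assms
proof (induction "card B" arbitrary: A B rule: less_induct)
  case less
  have fin: "finite A" "finite B" using less.prems(2,3) finite_subset by blast+
  have res: "x mod m = x" if "x \<in> A \<or> x \<in> B" for x using that less.prems(2,3) by auto
  show ?case
  proof (cases "B = {0}")
    case True
    then have "sumset_mod m A B = A"
      using res by (force simp: sumset_mod_def image_iff)
    then show ?thesis using True by simp
  next
    case False
    then obtain b where b: "b \<in> B" "b \<noteq> 0" using less.prems(5) by blast
    \<comment> \<open>If \<open>A\<close> were closed under the shift by \<open>b\<close>, it would
      contain \<open>- b\<close>, and 0 would have a second representation.\<close>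
    have "\<exists>e\<in>A. (e + b) mod m \<notin> A"
    proof (rule ccontr)
      assume "\<not> ?thesis"
      then have n: "(- b) mod m \<in> A"
        using shift_closed_contains_negative[of m A b] less.prems(1,4) by blast
      have "m dvd (- b) mod m + b" by (simp add: dvd_eq_mod_eq_0 mod_simps)
      then show False using less.prems(6)[OF n b(1)] b by blast
    qed
    then obtain e where e: "e \<in> A" "(e + b) mod m \<notin> A" by blast
    \<comment> \<open>\<open>C\<close> is the part of \<open>B\<close> that leaves, and its
      translate \<open>D\<close> is disjoint from \<open>A\<close>, so the two cardinalities keep
      their sum. Since \<open>b\<close> leaves, the new \<open>B'\<close> is strictly smaller; since
      \<open>e + 0\<close> lies in \<open>A\<close>, 0 stays.\<close>
    define C where "C = {c \<in> B. (e + c) mod m \<notin> A}"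
    define B' where "B' = B - C"
    define D where "D = (\<lambda>c. (e + c) mod m) ` C"
    define A' where "A' = A \<union> D"
    have C: "b \<in> C" "C \<subseteq> B" using b e by (auto simp: C_def)
    have zB': "0 \<in> B'" using less.prems(5) e res by (auto simp: B'_def C_def)
    have "inj_on (\<lambda>c. (e + c) mod m) C"
    proof (rule inj_onI)
      fix x y assume xy: "x \<in> C" "y \<in> C" "(e + x) mod m = (e + y) mod m"
      then have "m dvd x - y" by (simp add: mod_eq_dvd_iff)
      then have "x mod m = y mod m" by (simp add: mod_eq_dvd_iff)
      then show "x = y" using xy C(2) res by (metis subsetD)
    qed
    then have cD: "card D = card C" by (simp add: D_def card_image)
    have "A \<inter> D = {}" by (auto simp: C_def D_def)
    then have cA': "card A' = card A + card C"
      using fin cD C by (metis A'_def D_def card_Un_disjoint finite_imageI finite_subset)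
    have cB': "card B' = card B - card C" "card B' < card B" "card C \<le> card B"
      using fin C card_Diff_subset[of C B] psubset_card_mono[of B B'] card_mono[of B C]
      by (auto simp: B'_def dest: finite_subset)
    have eB': "(e + c) mod m \<in> A" if "c \<in> B'" for c using that by (auto simp: B'_def C_def)
    have "card A' + card B' \<le> card (sumset_mod m A' B') + 1"
    proof (rule less.hyps[OF cB'(2)])
      show "m > 0" "0 \<in> B'" by fact+
      show "A' \<subseteq> {0..<m}" using less.prems(1,2) by (auto simp: A'_def D_def)
      show "B' \<subseteq> {0..<m}" using less.prems(3) by (auto simp: B'_def)
      show "0 \<in> A'" using less.prems(4) by (auto simp: A'_def)
      fix a b assume ab: "a \<in> A'" "b \<in> B'" "m dvd a + b"
      show "a = 0 \<and> b = 0"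
      proof (cases "a \<in> A")
        case True
        then show ?thesis using less.prems(6) ab by (auto simp: B'_def)
      next
        case False
        then obtain c where c: "c \<in> C" "a = (e + c) mod m" using ab by (auto simp: A'_def D_def)
        \<comment> \<open>The regrouping \<open>(e + c) + b = (e + b) + c\<close> turns a new sum
          into an old one, because \<open>e + b\<close> lies in \<open>A\<close> for every
          \<open>b\<close> that stays. Uniqueness then gives \<open>c = 0\<close>, so that
          \<open>a = e\<close> would lie in \<open>A\<close>.\<close>
        have "m dvd e + c + b" using ab(3) c by (simp add: dvd_eq_mod_eq_0 mod_simps)
        then have "m dvd (e + b) mod m + c" by (simp add: dvd_eq_mod_eq_0 mod_simps algebra_simps)
        then have "(e + b) mod m = 0 \<and> c = 0" using less.prems(6) eB'[OF ab(2)] c C by blast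
        then show ?thesis using c e False res by auto
      qed
    qed
    moreover have "sumset_mod m A' B' \<subseteq> sumset_mod m A B"
    proof -
      have "(a + b) mod m \<in> sumset_mod m A B" if ab: "a \<in> A'" "b \<in> B'" for a b
      proof (cases "a \<in> A")
        case True
        then show ?thesis using ab by (auto simp: sumset_mod_def B'_def)
      next
        case False
        then obtain c where c: "c \<in> C" "a = (e + c) mod m" using ab by (auto simp: A'_def D_def)
        have "(a + b) mod m = ((e + b) mod m + c) mod m"
          using c by (simp add: mod_simps algebra_simps)
        then show ?thesis using eB'[OF ab(2)] c C by (auto simp: sumset_mod_def)
      qed
      then show ?thesis by (auto simp: sumset_mod_def)
    qed
    then have "card (sumset_mod m A' B') \<le> card (sumset_mod m A B)"
      using fin by (intro card_mono) (auto simp: sumset_mod_def)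
    ultimately show ?thesis using cA' cB' by linarith
  qed
qed

section \<open>Subset sums under concatenation\<close>

lemma subsums_union: "subsums m (S + T) = sumset_mod m (subsums m S) (subsums m T)"
proof (intro equalityI subsetI)
  fix x assume "x \<in> subsums m (S + T)"
  then obtain A where A: "A \<subseteq># S + T" "x = sum_mset A mod m" by (auto simp: subsums_def)
  \<comment> \<open>Take as much of \<open>A\<close> as possible from \<open>S\<close>; the
    remainder fits into \<open>T\<close>.\<close>
  have "A - S \<subseteq># T" using A(1) by (simp add: subset_eq_diff_conv add.commute)
  moreover have "A \<inter># S \<subseteq># S" by simp
  moreover have "A = A \<inter># S + (A - S)"
    by (rule multiset_eqI) (simp add: min_def)
  then have "x = (sum_mset (A \<inter># S) mod m + sum_mset (A - S) mod m) mod m"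
    using A(2) by (metis mod_add_eq sum_mset.union)
  ultimately show "x \<in> sumset_mod m (subsums m S) (subsums m T)"
    unfolding sumset_mod_def subsums_def by force
next
  fix x assume "x \<in> sumset_mod m (subsums m S) (subsums m T)"
  then obtain A B where "A \<subseteq># S" "B \<subseteq># T" "x = (sum_mset A + sum_mset B) mod m"
    by (auto simp: sumset_mod_def subsums_def mod_simps)
  then show "x \<in> subsums m (S + T)"
    unfolding subsums_def by (intro image_eqI[of _ _ "A + B"]) (auto intro: subset_mset.add_mono)
qed

lemma subsums_bounds:
  assumes "m > 0"
  shows "subsums m S \<subseteq> {0..<m}" "0 \<in> subsums m S" "finite (subsums m S)" "int (card (subsums m S)) \<le> m"
proof -
  show *: "subsums m S \<subseteq> {0..<m}" using assms by (auto simp: subsums_def)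
  then show "finite (subsums m S)" using finite_subset by blast
  show "0 \<in> subsums m S" unfolding subsums_def by (intro image_eqI[of _ _ "{#}"]) auto
  show "int (card (subsums m S)) \<le> m"
    using card_mono[OF _ *] assms by simp
qed

lemma subsumsI: "A \<subseteq># S \<Longrightarrow> sum_mset A = x \<Longrightarrow> x mod m \<in> subsums m S"
  by (auto simp: subsums_def)

lemma zero_sum_free_mono: "zero_sum_free m S \<Longrightarrow> T \<subseteq># S \<Longrightarrow> zero_sum_free m T"
  unfolding zero_sum_free_def using subset_mset.order_trans by blast

lemma zero_sum_freeD: "zero_sum_free m S \<Longrightarrow> A \<subseteq># S \<Longrightarrow> A \<noteq> {#} \<Longrightarrow> \<not> m dvd sum_mset A"
  by (auto simp: zero_sum_free_def)

text \<open>Two subset sums adding up to 0 combine to a zero-sum submultiset of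
  \<open>S + T\<close>, which must be empty. This is the uniqueness that \<open>scherk\<close> asks
  for.\<close>

lemma card_subsums_union:
  assumes "m > 0" "zero_sum_free m (S + T)"
  shows "card (subsums m S) + card (subsums m T) \<le> card (subsums m (S + T)) + 1"
  unfolding subsums_union
proof (rule scherk)
  fix a b assume "a \<in> subsums m S" "b \<in> subsums m T" "m dvd a + b"
  then obtain A B where AB: "A \<subseteq># S" "B \<subseteq># T" "a = sum_mset A mod m" "b = sum_mset B mod m"
    "m dvd sum_mset (A + B)"
    by (auto simp: subsums_def dvd_eq_mod_eq_0 mod_simps)
  then have "A + B = {#}"
    using zero_sum_freeD[OF assms(2), of "A + B"] by (auto intro: subset_mset.add_mono)
  then show "a = 0 \<and> b = 0" using AB by simp
qed (use assms(1) subsums_bounds in auto)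

text \<open>A single element \<open>x\<close> has the two subset sums 0 and \<open>x\<close>, so
  each element adds at least one.\<close>

lemma card_subsums_ge_size:
  assumes "m > 0" "zero_sum_free m S"
  shows "size S + 1 \<le> card (subsums m S)"
  using assms(2)
proof (induction S)
  case empty
  then show ?case by (simp add: subsums_def)
next
  case (add x S)
  have "\<not> m dvd x" using zero_sum_freeD[OF add.prems, of "{#x#}"] by simp
  moreover have "{0, x mod m} \<subseteq> subsums m {#x#}"
    using subsumsI[of "{#x#}" "{#x#}" x m] subsums_bounds(2)[OF assms(1)] by simp
  ultimately have "2 \<le> card (subsums m {#x#})"
    using card_mono[OF subsums_bounds(3)[OF assms(1)], of "{0, x mod m}" "{#x#}"]
    by (simp add: dvd_eq_mod_eq_0)
  moreover have "size S + 1 \<le> card (subsums m S)"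
    by (rule add.IH[OF zero_sum_free_mono[OF add.prems]]) simp
  ultimately show ?case
    using card_subsums_union[of m "{#x#}" S] assms(1) add.prems by simp
qed

lemma card_subsums_ge_length:
  assumes "m > 0" "set xs \<subseteq> subsums m S" "distinct xs"
  shows "length xs \<le> card (subsums m S)"
  using card_mono[OF subsums_bounds(3)[OF assms(1)] assms(2)] distinct_card[OF assms(3)] by simp

section \<open>Subset sums of pairs and triples\<close>

lemma card_subsums_pair:
  assumes m: "m > 0" and zf: "zero_sum_free m {#a, b#}" and "\<not> m dvd a - b"
  shows "4 \<le> card (subsums m {#a, b#})"
proof -
  have "set [(a + b) mod m, a mod m, b mod m, 0] \<subseteq> subsums m {#a, b#}"
    using subsums_bounds(2)[OF m, of "{#a,b#}"] subsumsI[of "{#a#}" "{#a,b#}" a m]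
      subsumsI[of "{#b#}" "{#a,b#}" b m] subsumsI[of "{#a,b#}" "{#a,b#}" "a+b" m] by simp
  moreover have "\<not> m dvd a" "\<not> m dvd b" "\<not> m dvd a + b"
    using zero_sum_freeD[OF zf, of "{#a#}"] zero_sum_freeD[OF zf, of "{#b#}"]
      zero_sum_freeD[OF zf, of "{#a,b#}"] by simp_all
  then have "distinct [(a + b) mod m, a mod m, b mod m, 0]"
    using assms(3) by (simp add: mod_eq_dvd_iff) (simp add: dvd_eq_mod_eq_0)
  ultimately show ?thesis using card_subsums_ge_length[OF m] by fastforce
qed

lemma subsums_triple:
  assumes "m > 0"
  shows "set [(a + b + c) mod m, (b + c) mod m, (a + c) mod m, (a + b) mod m,
     c mod m, b mod m, a mod m, 0] \<subseteq> subsums m {#a, b, c#}"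
  using subsums_bounds(2)[OF assms, of "{#a,b,c#}"]
    subsumsI[of "{#a#}" "{#a,b,c#}" a m] subsumsI[of "{#b#}" "{#a,b,c#}" b m]
    subsumsI[of "{#c#}" "{#a,b,c#}" c m] subsumsI[of "{#a,b#}" "{#a,b,c#}" "a+b" m]
    subsumsI[of "{#a,c#}" "{#a,b,c#}" "a+c" m] subsumsI[of "{#b,c#}" "{#a,b,c#}" "b+c" m]
    subsumsI[of "{#a,b,c#}" "{#a,b,c#}" "a+b+c" m] by (simp add: add.assoc)

lemma zero_sum_free_tripleD:
  assumes "zero_sum_free m {#a, b, c#}"
  shows "\<not> m dvd a" "\<not> m dvd b" "\<not> m dvd c" "\<not> m dvd a + b" "\<not> m dvd a + c" "\<not> m dvd b + c"
    "\<not> m dvd a + b + c"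
  using zero_sum_freeD[OF assms, of "{#a#}"] zero_sum_freeD[OF assms, of "{#b#}"]
    zero_sum_freeD[OF assms, of "{#c#}"] zero_sum_freeD[OF assms, of "{#a,b#}"]
    zero_sum_freeD[OF assms, of "{#a,c#}"] zero_sum_freeD[OF assms, of "{#b,c#}"]
    zero_sum_freeD[OF assms, of "{#a,b,c#}"] by (simp_all add: add.assoc)

text \<open>After cancelling common terms, two equal subset sums give a zero sum, an equality of two
  elements, or a relation \<open>x + y = z\<close>. Only the last kind is possible here, and each
  further relation that is excluded admits one more sum of two elements to the list.\<close>

lemma card_subsums_triple:
  assumes m: "m > 0" and zf: "zero_sum_free m {#a, b, c#}"
    and d: "\<not> m dvd a - b" "\<not> m dvd a - c" "\<not> m dvd b - c" and r1: "\<not> m dvd a + b - c"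
  shows "6 \<le> card (subsums m {#a, b, c#})"
    and "\<not> m dvd a + c - b \<Longrightarrow> 7 \<le> card (subsums m {#a, b, c#})"
    and "\<not> m dvd a + c - b \<Longrightarrow> \<not> m dvd b + c - a \<Longrightarrow> 8 \<le> card (subsums m {#a, b, c#})"
proof -
  note z = zero_sum_free_tripleD[OF zf]
  note z0 = z[unfolded dvd_eq_mod_eq_0]
  have d': "\<not> m dvd b - a" "\<not> m dvd c - a" "\<not> m dvd c - b"
    using d by (simp_all add: dvd_diff_commute)
  note less = card_subsums_ge_length[OF m, of _ "{#a,b,c#}"]
  note facts = z z0 d d' r1
  show "6 \<le> card (subsums m {#a, b, c#})"
  proof -
    let ?xs = "[(a + b + c) mod m, (a + b) mod m, c mod m, b mod m, a mod m, 0]"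
    have "distinct ?xs" using facts by (simp add: mod_eq_dvd_iff algebra_simps)
    then show ?thesis using less[of ?xs] subsums_triple[OF m, of a b c] by simp
  qed
  assume r2: "\<not> m dvd a + c - b"
  show "7 \<le> card (subsums m {#a, b, c#})"
  proof -
    let ?xs = "[(a + b + c) mod m, (a + c) mod m, (a + b) mod m, c mod m, b mod m, a mod m, 0]"
    have "distinct ?xs" using facts r2 by (simp add: mod_eq_dvd_iff algebra_simps)
    then show ?thesis using less[of ?xs] subsums_triple[OF m, of a b c] by simp
  qed
  assume r3: "\<not> m dvd b + c - a"
  show "8 \<le> card (subsums m {#a, b, c#})"
  proof -
    let ?xs = "[(a + b + c) mod m, (b + c) mod m, (a + c) mod m, (a + b) mod m,
      c mod m, b mod m, a mod m, 0]"
    have "distinct ?xs" using facts r2 r3 by (simp add: mod_eq_dvd_iff algebra_simps)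
    then show ?thesis using less[of ?xs] subsums_triple[OF m, of a b c] by simp
  qed
qed

section \<open>Unrelated triples among four elements\<close>

text \<open>If every triple among four elements satisfied a relation \<open>x = y + z\<close>, two triples would force
  the shape \<open>a, d, a + d, 2a + d\<close>, in which the triple without \<open>a\<close> satisfies none.\<close>

lemma no_relation_in_third_triple:
  fixes m :: int
  assumes zf: "zero_sum_free m {#a, b, c, d#}" and "\<not> m dvd a - d"
    and c: "m dvd a + b - c" and b: "m dvd a + d - b"
  shows "\<not> m dvd c + d - b" "\<not> m dvd b + d - c" "\<not> m dvd b + c - d"
proof -
  have z: "\<not> m dvd b" "\<not> m dvd a + c"
    using zero_sum_freeD[OF zf, of "{#b#}"] zero_sum_freeD[OF zf, of "{#a,c#}"] by simp_all
  show "\<not> m dvd c + d - b"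
  proof
    assume "m dvd c + d - b"
    then have "m dvd (c + d - b) + (a + b - c) - (a + d - b)"
      using c b dvd_add dvd_diff by blast
    then show False using z by simp
  qed
  show "\<not> m dvd b + d - c"
  proof
    assume "m dvd b + d - c"
    then have "m dvd (a + b - c) - (b + d - c)" using c dvd_diff by blast
    then show False using assms(2) by simp
  qed
  show "\<not> m dvd b + c - d"
  proof
    assume "m dvd b + c - d"
    then have "m dvd (b + c - d) + (a + d - b)" using b dvd_add by blast
    then show False using z by (simp add: add.commute)
  qed
qed

text \<open>For three distinct residues forming a zero-sum-free triple, this says that all eight
  subset sums are distinct.\<close>

definition unrelated :: "int \<Rightarrow> int \<Rightarrow> int \<Rightarrow> int \<Rightarrow> bool"
  where "unrelated m a b c \<longleftrightarrow> \<not> m dvd a + b - c \<and> \<not> m dvd a + c - b \<and> \<not> m dvd b + c - a"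

text \<open>Given \<open>c = a + b\<close>, the element \<open>d\<close> is not
  \<open>a + b\<close>, so a relation on \<open>a, b, d\<close> must be \<open>b = a + d\<close> or
  \<open>a = b + d\<close>. The first makes \<open>b, c, d\<close> unrelated, and by symmetry the
  second makes \<open>a, c, d\<close> unrelated.\<close>

lemma ex_unrelated_triple_aux:
  assumes zf: "zero_sum_free m {#a, b, c, d#}"
    and d: "\<not> m dvd a - d" "\<not> m dvd b - d" "\<not> m dvd c - d"
    and c: "m dvd a + b - c"
  shows "unrelated m a b d \<or> unrelated m b c d \<or> unrelated m a c d"
proof (rule ccontr)
  assume *: "\<not> ?thesis"
  have "\<not> m dvd a + b - d"
  proof
    assume "m dvd a + b - d"
    then have "m dvd (a + b - d) - (a + b - c)" using c dvd_diff by blast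
    then show False using d(3) by simp
  qed
  then consider "m dvd a + d - b" | "m dvd b + d - a" using * by (auto simp: unrelated_def)
  then show False
  proof cases
    case 1
    then show False using no_relation_in_third_triple[OF zf d(1) c] *
      by (auto simp: unrelated_def)
  next
    case 2
    have "zero_sum_free m {#b, a, c, d#}" using zf by (simp add: add_mset_commute)
    then show False using no_relation_in_third_triple[of m b a c d] d(2) c 2 *
      by (auto simp: unrelated_def add.commute)
  qed
qed

lemma ex_unrelated_triple:
  assumes zf: "zero_sum_free m {#a, b, c, d#}"
    and d: "\<not> m dvd a - b" "\<not> m dvd a - c" "\<not> m dvd b - c"
      "\<not> m dvd a - d" "\<not> m dvd b - d" "\<not> m dvd c - d"
  shows "unrelated m a b c \<or> unrelated m a b d \<or> unrelated m b c d \<or> unrelated m a c d"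
proof -
  have zf': "zero_sum_free m {#a, c, b, d#}" "zero_sum_free m {#b, c, a, d#}"
    using zf by (simp_all add: add_mset_commute)
  consider "unrelated m a b c" | "m dvd a + b - c" | "m dvd a + c - b" | "m dvd b + c - a"
    by (auto simp: unrelated_def)
  then show ?thesis
  proof cases
    case 2
    then show ?thesis using ex_unrelated_triple_aux[OF zf] d by blast
  next
    case 3
    then show ?thesis using ex_unrelated_triple_aux[OF zf'(1)] d
      by (auto simp: unrelated_def add.commute)
  next
    case 4
    then show ?thesis using ex_unrelated_triple_aux[OF zf'(2)] d
      by (auto simp: unrelated_def add.commute)
  qed simp
qed

section \<open>Subset sums of a set of residues\<close>

lemma not_dvd_diff_residues:
  fixes m :: int
  assumes "U \<subseteq> {0<..<m}" "a \<in> U" "b \<in> U" "a \<noteq> b"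
  shows "\<not> m dvd a - b"
proof
  assume "m dvd a - b"
  then have "a mod m = b mod m" by (simp add: mod_eq_dvd_iff)
  moreover have "a mod m = a" "b mod m = b" using assms by auto
  ultimately show False using assms(4) by simp
qed

lemma double_residue:
  fixes a :: int
  assumes "0 < a" "a < m" "m dvd 2 * a"
  shows "m = 2 * a"
proof -
  obtain i where i: "2 * a = m * i" using assms(3) by blast
  have "0 < m * i" "m * i < m * 2" "m > 0" using assms i by linarith+
  then have "0 < i" "i < 2" using mult_less_cancel_left_pos[of m i 2] by (simp_all add: zero_less_mult_iff)
  then have "i = 1" by simp
  then show ?thesis using i by simp
qed

text \<open>Adding the relations in pairs gives \<open>2 * a\<close> and \<open>2 * b\<close>
  congruent to 0, so both elements would be \<open>m / 2\<close>.\<close>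

lemma not_all_triple_relations:
  fixes m :: int
  assumes "{a, b, c} \<subseteq> {0<..<m}" "distinct [a, b, c]"
  shows "\<not> (m dvd a + b - c \<and> m dvd a + c - b \<and> m dvd b + c - a)"
proof
  assume *: "m dvd a + b - c \<and> m dvd a + c - b \<and> m dvd b + c - a"
  then have "m dvd (a + b - c) + (a + c - b)" "m dvd (a + b - c) + (b + c - a)"
    by (metis dvd_add)+
  then have "m = 2 * a" "m = 2 * b" using assms(1) by (intro double_residue; simp)+
  then show False using assms(2) by simp
qed

text \<open>Up to three elements the sums are counted directly. For \<open>n >= 4\<close>, an
  unrelated triple contributes 8 sums and the rest at least \<open>2 * (n - 3)\<close>, so
  superadditivity gives \<open>8 + 2 * (n - 3) - 1 = 2 * n + 1\<close>. The weaker bound for all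
  sizes is what the induction uses.\<close>

lemma card_subsums_set_bound:
  assumes m: "m > 0" and U: "U \<subseteq> {0<..<m}" "zero_sum_free m (mset_set U)"
  shows "2 * card U \<le> card (subsums m (mset_set U)) \<and>
    (4 \<le> card U \<longrightarrow> 2 * card U + 1 \<le> card (subsums m (mset_set U)))"
  using U
proof (induction "card U" arbitrary: U rule: less_induct)
  case less
  have fin: "finite U" using less.prems(1) finite_subset by blast
  have sub: "zero_sum_free m (mset_set V)" if "V \<subseteq> U" for V
    using zero_sum_free_mono[OF less.prems(2)] that fin
    by (simp add: subset_imp_msubset_mset_set)
  have nd: "\<not> m dvd x - y" if "x \<in> U" "y \<in> U" "x \<noteq> y" for x y
    using not_dvd_diff_residues[OF less.prems(1)] that by blast
  consider "card U = 0" | "card U = 1" | "card U = 2" | "card U = 3" | "4 \<le> card U" by linarith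
  then show ?case
  proof cases
    case 1
    then show ?thesis by simp
  next
    case 2
    then show ?thesis using card_subsums_ge_size[OF m less.prems(2)] by simp
  next
    case 3
    then obtain a b where U: "U = {a, b}" "a \<noteq> b" by (auto simp: card_2_iff)
    then show ?thesis using card_subsums_pair[OF m, of a b] less.prems(2) nd[of a b] by simp
  next
    case 4
    then obtain a b c where U: "U = {a, b, c}" "a \<noteq> b" "a \<noteq> c" "b \<noteq> c"
      by (auto simp: card_3_iff)
    have nn: "\<not> m dvd a - b" "\<not> m dvd b - a" "\<not> m dvd a - c" "\<not> m dvd c - a"
      "\<not> m dvd b - c" "\<not> m dvd c - b"
      using nd U by auto
    have ms: "mset_set U = {#a, b, c#}" "mset_set U = {#a, c, b#}" "mset_set U = {#b, c, a#}"
      using U by (auto simp: add_mset_commute)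
    note zf = less.prems(2)[unfolded ms(1)] less.prems(2)[unfolded ms(2)] less.prems(2)[unfolded ms(3)]
    consider "\<not> m dvd a + b - c" | "\<not> m dvd a + c - b" | "\<not> m dvd b + c - a"
      using not_all_triple_relations[of a b c m] less.prems(1) U by auto
    then have "6 \<le> card (subsums m (mset_set U))"
    proof cases
      case 1
      then show ?thesis using card_subsums_triple(1)[OF m zf(1)] nn unfolding ms(1) by blast
    next
      case 2
      then show ?thesis using card_subsums_triple(1)[OF m zf(2)] nn unfolding ms(2) by blast
    next
      case 3
      then show ?thesis using card_subsums_triple(1)[OF m zf(3)] nn unfolding ms(3) by blast
    qed
    then show ?thesis using 4 by simp
  next
    case 5
    obtain V where V: "V \<subseteq> U" "card V = 4" using obtain_subset_with_card_n[OF 5] by blast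
    then obtain a W where W: "V = insert a W" "a \<notin> W" "card W = 3"
      by (metis card_Suc_eq eval_nat_numeral(2) numeral_3_eq_3 semiring_norm(26) semiring_norm(27))
    then obtain b c d where "W = {b, c, d}" "b \<noteq> c" "b \<noteq> d" "c \<noteq> d" by (auto simp: card_3_iff)
    then have V': "V = {a, b, c, d}" "distinct [a, b, c, d]" using W by auto
    have "zero_sum_free m {#a, b, c, d#}" using sub[OF V(1)] V' by simp
    then have "unrelated m a b c \<or> unrelated m a b d \<or> unrelated m b c d \<or> unrelated m a c d"
      using V V' by (intro ex_unrelated_triple nd) auto
    then obtain x y z where xyz: "{x, y, z} \<subseteq> U" "distinct [x, y, z]" "unrelated m x y z"
      using V V' by auto
    let ?W = "U - {x, y, z}"
    have zfx: "zero_sum_free m {#x, y, z#}" using sub[OF xyz(1)] xyz(2) by simp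
    have "8 \<le> card (subsums m {#x, y, z#})"
      using xyz nd[of x y] nd[of x z] nd[of y z]
      by (intro card_subsums_triple(3)[OF m zfx]) (auto simp: unrelated_def)
    moreover have cW: "card ?W = card U - 3" using xyz fin by (simp add: card_Diff_subset)
    have "2 * card ?W \<le> card (subsums m (mset_set ?W))"
      using less.hyps[of ?W] cW 5 less.prems(1) sub[of ?W] by auto
    moreover have U: "mset_set U = {#x, y, z#} + mset_set ?W"
    proof -
      have "mset_set U = mset_set ({x, y, z} \<union> ?W)" using xyz(1) by (intro arg_cong[of _ _ mset_set]) blast
      also have "\<dots> = mset_set {x, y, z} + mset_set ?W" using fin by (intro mset_set_Union) auto
      finally show ?thesis using xyz(2) by simp
    qed
    then have "card (subsums m {#x, y, z#}) + card (subsums m (mset_set ?W))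
        \<le> card (subsums m (mset_set U)) + 1"
      using card_subsums_union[OF m, of "{#x, y, z#}" "mset_set ?W"] less.prems(2) by simp
    ultimately show ?thesis using cW 5 by linarith
  qed
qed

section \<open>Length of minimal zero-sum sequences\<close>

lemma minimal_zero_sumD:
  "minimal_zero_sum m S \<Longrightarrow> A \<subset># S \<Longrightarrow> A \<noteq> {#} \<Longrightarrow> \<not> m dvd sum_mset A"
  by (auto simp: minimal_zero_sum_def)

lemma zero_sum_free_proper_submultiset:
  assumes "minimal_zero_sum m S" "T \<subset># S"
  shows "zero_sum_free m T"
  using assms minimal_zero_sumD subset_mset.le_less_trans unfolding zero_sum_free_def by blast

lemma minimal_zero_sum_no_antipodes:
  assumes "minimal_zero_sum m S" "x \<in># S" "y \<in># S" "x + y = m" "size S \<ge> 3"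
  shows "x = y"
proof (rule ccontr)
  assume "x \<noteq> y"
  then have "{#x, y#} \<subseteq># S"
    using assms(2,3) by (simp add: insert_subset_eq_iff in_diff_count)
  then have "{#x, y#} \<subset># S" using assms(5) by (auto simp: subset_mset.less_le)
  from minimal_zero_sumD[OF assms(1) this] show False using assms(4) by simp
qed

text \<open>The support and its negative share at most \<open>m / 2\<close>, so their union has at
  least \<open>2 * card - 1\<close> of the \<open>m - 1\<close> nonzero residues.\<close>

lemma minimal_zero_sum_card_bound:
  assumes S: "minimal_zero_sum m S" "set_mset S \<subseteq> {0<..<m}" "size S \<ge> 3"
  shows "2 * int (card (set_mset S)) \<le> m"
proof -
  let ?U = "set_mset S"
  let ?V = "(\<lambda>x. m - x) ` ?U"
  have "x = m - x" if "x \<in> ?U \<inter> ?V" for x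
    using that minimal_zero_sum_no_antipodes[OF S(1), of x "m - x"] S(3) by auto
  then have "?U \<inter> ?V \<subseteq> {m div 2}" by force
  then have "card (?U \<inter> ?V) \<le> 1" using card_mono[of "{m div 2}"] by fastforce
  moreover have "card ?V = card ?U" by (intro card_image) (auto simp: inj_on_def)
  moreover have "card (?U \<union> ?V) \<le> card {0<..<m}"
    using S(2) by (intro card_mono) (auto simp: subset_iff)
  moreover have "card ?U + card ?V = card (?U \<union> ?V) + card (?U \<inter> ?V)"
    by (intro card_Un_Int) auto
  moreover have "m > 0" using S(2,3) by (cases S) auto
  ultimately show ?thesis by simp
qed

text \<open>Without one copy of \<open>x\<close>, the sequence still has support \<open>U\<close>
  and is \<open>U\<close> together with some \<open>R\<close>. Then
  \<open>card (subsums m U) + (size R + 1) <= m + 1\<close>, where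
  \<open>size R = size S - 1 - card U\<close>.\<close>

lemma size_bound_repeated:
  assumes m: "m > 0" and S: "minimal_zero_sum m S" and x: "count S x \<ge> 2"
  defines "U \<equiv> set_mset S"
  shows "zero_sum_free m (mset_set U)"
    and "int (card (subsums m (mset_set U)) + size S) \<le> m + 1 + int (card U)"
proof -
  have "x \<in># S" by (rule count_inI) (use x in simp)
  then obtain T where ST: "S = add_mset x T" by (rule mset_add)
  have T: "T \<subset># S" "size T + 1 = size S" by (simp_all add: ST)
  have "x \<in># T" by (rule count_inI) (use x ST in simp)
  then have "set_mset T = U" by (auto simp: U_def ST)
  then have U: "mset_set U \<subseteq># T" using mset_set_set_mset_msubset by blast
  have zf: "zero_sum_free m T" using zero_sum_free_proper_submultiset S T by blast
  then show "zero_sum_free m (mset_set U)" using zero_sum_free_mono U by blast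
  obtain R where TR: "T = mset_set U + R" using U by (auto simp: mset_subset_eq_exists_conv)
  have "size T = card U + size R" by (simp add: TR)
  moreover have "size R + 1 \<le> card (subsums m R)"
    using card_subsums_ge_size[OF m zero_sum_free_mono[OF zf]] by (simp add: TR)
  moreover have "card (subsums m (mset_set U)) + card (subsums m R) \<le> card (subsums m T) + 1"
    using card_subsums_union[OF m zf[unfolded TR]] by (simp add: TR)
  moreover have "int (card (subsums m T)) \<le> m" using subsums_bounds(4)[OF m] .
  ultimately show "int (card (subsums m (mset_set U)) + size S) \<le> m + 1 + int (card U)"
    using T(2) by linarith
qed

text \<open>Modulo \<open>h\<close> the elements \<open>a\<close> and \<open>b\<close> coincide, so \<open>h\<close> of them sum to 0 modulo \<open>h\<close>;
  exchanging one \<open>a\<close> for \<open>b\<close> adjusts the sum to 0 modulo \<open>2h\<close>.\<close>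

lemma size_bound_half_triple:
  assumes S: "minimal_zero_sum m S" "set_mset S = {a, b, h}" "distinct [a, b, h]"
    and h: "m = 2 * h" "h > 0" and ab: "m dvd a + h - b"
  shows "int (size S) \<le> h + 1"
proof (rule ccontr)
  assume large: "\<not> ?thesis"
  define k where "k = nat h"
  define x where "x = count S a"
  define y where "y = count S b"
  have k: "h = int k" "k > 0" using h by (simp_all add: k_def)
  have pos: "x > 0" "y > 0" "count S h > 0"
    using S(2) by (auto simp: x_def y_def)
  \<comment> \<open>Two copies of \<open>h\<close> already sum to \<open>m\<close>.\<close>
  have "count S h = 1"
  proof (rule ccontr)
    assume "count S h \<noteq> 1"
    then have "count S h \<ge> 2" using pos by linarith
    then have "{#h, h#} \<subseteq># S" by (simp add: subseteq_mset_def)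
    moreover have "a \<in># S" "a \<notin># {#h, h#}" using S(2,3) by auto
    ultimately have "{#h, h#} \<subset># S" by (auto simp: subset_mset.less_le)
    from minimal_zero_sumD[OF S(1) this] show False using h by simp
  qed
  then have "size S = x + y + 1"
    using S(2,3) by (simp add: size_multiset_overloaded_eq x_def y_def)
  then have xy: "x + y > k" using large k by simp
  \<comment> \<open>Here \<open>i\<close> will be the number of copies of \<open>b\<close> among
    \<open>k\<close> terms. Both \<open>k - x\<close> and \<open>k - x + 1\<close> are admissible
    because \<open>x + y > k\<close>, and one of them has the required parity; the truncated
    \<open>k - x\<close> is 0 when there are enough copies of \<open>a\<close>.\<close>
  have "\<exists>i. k \<le> i + x \<and> i \<le> y \<and> i \<le> k \<and> even (a + int i)"
  proof (cases "even (a + int (k - x))")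
    case True
    then show ?thesis using xy pos by (intro exI[of _ "k - x"]) auto
  next
    case False
    then show ?thesis using xy pos k by (intro exI[of _ "k - x + 1"]) auto
  qed
  then obtain i where i: "k \<le> i + x" "i \<le> y" "i \<le> k" "even (a + int i)" by blast
  define A where "A = replicate_mset (k - i) a + replicate_mset i b"
  have "A \<subseteq># S" using i S(3) by (auto simp: A_def subseteq_mset_def x_def y_def)
  moreover have "h \<in># S" "h \<notin># A" using S(2,3) by (auto simp: A_def split: if_splits)
  ultimately have "A \<subset># S" by (auto simp: subset_mset.less_le)
  moreover have "A \<noteq> {#}" using k i by (auto simp: A_def)
  moreover have "m dvd sum_mset A"
  proof -
    obtain t where t: "a + h - b = m * t" using ab by blast
    obtain u where u: "a + int i = 2 * u" using i(4) by blast
    have "sum_mset A = (h - int i) * a + int i * b"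
      using i k by (simp add: A_def sum_mset_replicate_mset of_nat_diff)
    also have "b = a + h - m * t" using t by simp
    also have "(h - int i) * a + int i * (a + h - m * t) = h * (a + int i) - m * (int i * t)"
      by (simp add: algebra_simps)
    also have "\<dots> = m * (u - int i * t)" by (simp add: u h algebra_simps)
    finally show ?thesis by simp
  qed
  ultimately show False using minimal_zero_sumD[OF S(1)] by blast
qed

text \<open>The two relations add up to \<open>2 * a = 0\<close>, so \<open>a = m / 2\<close> and
  the bound \<open>m / 2 + 1\<close> applies. It is at most \<open>m - 3\<close> because
  \<open>m\<close> is even and at least 7, hence at least 8.\<close>

lemma size_bound_related_triple:
  assumes S: "minimal_zero_sum m S" "set_mset S = {a, b, c}" "distinct [a, b, c]"
    "{a, b, c} \<subseteq> {0<..<m}"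
    and r: "m dvd a + b - c" "m dvd a + c - b" and m: "m \<ge> 7"
  shows "int (size S) + 3 \<le> m"
proof -
  have "m dvd (a + b - c) + (a + c - b)" using r by (rule dvd_add)
  then have h: "m = 2 * a" using S(4) by (intro double_residue) auto
  have "int (size S) \<le> a + 1"
    using S r h m by (intro size_bound_half_triple[of m S b c a]) (auto simp: add.commute)
  then show ?thesis using h m by presburger
qed

lemma minimal_zero_sum_size_bound:
  assumes S: "minimal_zero_sum m S" "set_mset S \<subseteq> {0<..<m}" "card (set_mset S) \<ge> 3" and m: "m \<ge> 7"
  shows "int (size S) + int (card (set_mset S)) \<le> m"
proof (cases "\<exists>x. count S x \<ge> 2")
  case False
  then have "count S x = 1" if "x \<in># S" for x
    using that by (metis One_nat_def Suc_leI count_greater_zero_iff le_antisym not_less_eq_eq numeral_2_eq_2)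
  then have "size S = card (set_mset S)" by (simp add: size_multiset_overloaded_eq)
  then show ?thesis using minimal_zero_sum_card_bound[OF S(1,2)] S(3) by simp
next
  case True
  then obtain x where x: "count S x \<ge> 2" by blast
  have m0: "m > 0" using m by simp
  let ?U = "set_mset S"
  note zf = size_bound_repeated(1)[OF m0 S(1) x] and bound = size_bound_repeated(2)[OF m0 S(1) x]
  show ?thesis
  proof (cases "card ?U \<ge> 4")
    case True
    \<comment> \<open>With \<open>s\<close> elements in the support,
      \<open>(2 * s + 1) + size S <= m + 1 + s\<close> is the claim.\<close>
    then have "2 * card ?U + 1 \<le> card (subsums m (mset_set ?U))"
      using card_subsums_set_bound[OF m0 S(2) zf] by blast
    then show ?thesis using bound by linarith
  next
    case False
    then have c3: "card ?U = 3" using S(3) by simp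
    then obtain a b c where U: "?U = {a, b, c}" and d: "a \<noteq> b" "a \<noteq> c" "b \<noteq> c"
      by (auto simp: card_3_iff)
    have nd: "\<not> m dvd y - z" if "y \<in> ?U" "z \<in> ?U" "y \<noteq> z" for y z
      using not_dvd_diff_residues[OF S(2)] that by blast
    have seven: ?thesis if 1: "?U = {p, q, r}" "distinct [p, q, r]"
      and 2: "\<not> m dvd p + q - r" "\<not> m dvd p + r - q" for p q r
    proof -
      have ms: "mset_set ?U = {#p, q, r#}" using 1 by simp
      have "7 \<le> card (subsums m {#p, q, r#})"
        using 1 2 nd[of p q] nd[of p r] nd[of q r] by (intro card_subsums_triple(2)[OF m0 zf[unfolded ms]]) auto
      then show ?thesis using bound c3 unfolding ms by simp
    qed
    have five: ?thesis if 1: "?U = {p, q, r}" "distinct [p, q, r]"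
      and 2: "m dvd p + q - r" "m dvd p + r - q" for p q r
      using size_bound_related_triple[OF S(1) 1 _ 2 m] S(2) 1(1) c3 by simp
    have perm: "?U = {b, a, c}" "?U = {c, a, b}" using U by auto
    have dist: "distinct [a, b, c]" "distinct [b, a, c]" "distinct [c, a, b]" using d by auto
    have comm: "b + a - c = a + b - c" "c + a - b = a + c - b" "c + b - a = b + c - a" by simp_all
    note sevens = seven[OF U dist(1)] seven[OF perm(1) dist(2), unfolded comm]
      seven[OF perm(2) dist(3), unfolded comm]
    note fives = five[OF U dist(1)] five[OF perm(1) dist(2), unfolded comm]
      five[OF perm(2) dist(3), unfolded comm]
    \<comment> \<open>Any two of the three relations share an element in the role of
      \<open>p\<close>. If two hold, one of \<open>fives\<close> applies; otherwise two fail, and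
      \<open>sevens\<close> gives \<open>7 + size S <= m + 1 + 3\<close>.\<close>
    show ?thesis
      by (cases "m dvd a + b - c"; cases "m dvd a + c - b"; cases "m dvd b + c - a")
        (erule (1) sevens fives)+
  qed
qed

section \<open>Supports with two elements\<close>

text \<open>Otherwise two copies of the pair \<open>{a, b}\<close> remain after removing one
  \<open>a\<close>. Each pair has 4 subset sums, so there would be at least
  \<open>4 + 4 + (size R + 1) - 2 = size T + 3 = m + 1\<close> sums modulo \<open>m\<close>.\<close>

lemma two_variables_count:
  assumes S: "minimal_zero_sum m S" "set_mset S = {a, b}" "a \<noteq> b" "{a, b} \<subseteq> {0<..<m}"
    and size: "int (size S) + 1 = m" and cnt: "count S a \<ge> 3"
  shows "count S b \<le> 1"
proof (rule ccontr)
  assume b: "\<not> ?thesis"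
  have m: "m > 0" using S(4) by auto
  have "a \<in># S" using S(2) by simp
  then obtain T where ST: "S = add_mset a T" by (rule mset_add)
  have T: "T \<subset># S" "size T + 1 = size S" by (simp_all add: ST)
  have "{#a, b#} + {#a, b#} \<subseteq># T"
    using b cnt S(3) by (auto simp: subseteq_mset_def ST)
  then obtain R where TR: "T = {#a, b#} + {#a, b#} + R" by (metis mset_subset_eq_exists_conv)
  have zf: "zero_sum_free m T" using zero_sum_free_proper_submultiset S(1) T by blast
  have zf': "zero_sum_free m {#a, b#}" "zero_sum_free m ({#a, b#} + {#a, b#})" "zero_sum_free m R"
    by (rule zero_sum_free_mono[OF zf]; simp add: TR)+
  have "\<not> m dvd a - b" using not_dvd_diff_residues[OF S(4)] S(3) by blast
  then have "4 \<le> card (subsums m {#a, b#})" using card_subsums_pair[OF m zf'(1)] by blast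
  moreover have "size R + 1 \<le> card (subsums m R)" by (rule card_subsums_ge_size[OF m zf'(3)])
  moreover have "size T = 4 + size R" by (simp add: TR)
  moreover have "int (card (subsums m T)) \<le> m" using subsums_bounds(4)[OF m] .
  ultimately show False
    using card_subsums_union[OF m zf'(2)] card_subsums_union[OF m zf[unfolded TR]] T(2) size
    unfolding TR by linarith
qed

lemma two_variables_large_count:
  assumes S: "minimal_zero_sum m S" "set_mset S = {a, b}" "a \<noteq> b" "{a, b} \<subseteq> {0<..<m}"
    and size: "int (size S) + 1 = m"
  shows "int (count S a) \<ge> m - 2 \<or> int (count S b) \<ge> m - 2"
proof (rule ccontr)
  assume *: "\<not> ?thesis"
  have sz: "size S = count S a + count S b"
    using S(2,3) by (simp add: size_multiset_overloaded_eq)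
  have "count S a \<ge> 3 \<Longrightarrow> count S b \<le> 1" using two_variables_count[OF S size] .
  moreover have "count S b \<ge> 3 \<Longrightarrow> count S a \<le> 1"
    using two_variables_count[of m S b a] S size by (auto simp: insert_commute)
  \<comment> \<open>The counts add up to \<open>m - 1\<close> and both lie below
    \<open>m - 2\<close>, so both are at least 2; a count of 3 or more would force the other down to
    1. This leaves \<open>m = 5\<close>, where 2 can be cancelled and the pair itself sums to
    0.\<close>
  ultimately have c: "count S a = 2" "count S b = 2" using sz size * by linarith+
  then have S': "S = {#a, b#} + {#a, b#}"
    using S(2,3) by (intro multiset_eqI) (auto simp: not_in_iff[symmetric])
  have "m = 5" using c sz size by simp
  moreover have "m dvd 2 * (a + b)" using S(1) S' by (simp add: minimal_zero_sum_def)
  ultimately have "m dvd a + b" by presburger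
  moreover have "{#a, b#} \<subset># S" by (simp add: S' subset_mset.less_le)
  ultimately show False using minimal_zero_sumD[OF S(1)] by fastforce
qed

section \<open>The exceptional modulus 6\<close>

lemma minimal_zero_sum_six:
  assumes S: "minimal_zero_sum 6 S" "set_mset S \<subseteq> {0<..<6}" "size S = 4" "card (set_mset S) = 3"
  shows "S = {#1, 3, 4, 4#} \<or> S = {#2, 2, 3, 5#}"
proof -
  define U where "U = set_mset S"
  have sub: "mset_set U \<subseteq># S" unfolding U_def by (rule mset_set_set_mset_msubset)
  then obtain R where R: "S = mset_set U + R" by (auto simp: mset_subset_eq_exists_conv)
  have "size (mset_set U) = 3" using S(4) by (simp add: U_def)
  then have "size R = 1" using S(3) R by simp
  then obtain x where Sx: "S = mset_set U + {#x#}" using R size_1_singleton_mset by blast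
  have "x \<in># S" by (simp add: Sx)
  then have xU: "x \<in> U" by (simp add: U_def)
  have "mset_set U \<subset># S" using Sx by simp
  moreover have "mset_set U \<noteq> {#}" using \<open>size (mset_set U) = 3\<close> by fastforce
  ultimately have ns: "\<not> 6 dvd sum_mset (mset_set U)" using minimal_zero_sumD[OF S(1)] by blast
  have "\<not> (1 \<in> U \<and> 5 \<in> U)" "\<not> (2 \<in> U \<and> 4 \<in> U)"
    using minimal_zero_sum_no_antipodes[OF S(1), of 1 5]
      minimal_zero_sum_no_antipodes[OF S(1), of 2 4] S(3) by (auto simp: U_def)
  moreover have "U \<subseteq> {1, 2, 3, 4, 5}" using S(2) by (fastforce simp: U_def)
  \<comment> \<open>The values 5 and 4 are defaults and assert no membership: as \<open>U\<close>
    contains no antipodal pair, it lies in \<open>{p, q, 3}\<close>, and equality follows by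
    counting. Two of the four resulting supports already sum to 0; in the others the sum determines
    the doubled element.\<close>
  moreover define p q :: int where "p = (if 1 \<in> U then 1 else 5)" and "q = (if 2 \<in> U then 2 else 4)"
  ultimately have "U \<subseteq> {p, q, 3}" by (auto split: if_splits)
  moreover have "card {p, q, 3} = 3" by (simp add: p_def q_def)
  ultimately have "U = {p, q, 3}" using S(4) by (intro card_seteq) (auto simp: U_def)
  moreover have "p = 1 \<or> p = 5" "q = 2 \<or> q = 4" by (simp_all add: p_def q_def)
  ultimately consider "U = {1, 2, 3}" | "U = {1, 4, 3}" | "U = {5, 2, 3}" | "U = {5, 4, 3}"
    by metis
  moreover have zs: "6 dvd x + sum_mset (mset_set U)"
    using S(1) Sx by (simp add: minimal_zero_sum_def)
  ultimately show ?thesis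
  proof cases
    case 2
    then have "x = 4" using xU zs by auto
    then show ?thesis using 2 by (simp add: Sx add_mset_commute)
  next
    case 3
    then have "x = 2" using xU zs by auto
    then show ?thesis using 3 by (simp add: Sx add_mset_commute)
  qed (use ns in simp_all)
qed

section \<open>From exponent vectors to sequences\<close>

text \<open>Integer entries allow the differences of residues used above.\<close>

definition index_mset :: "(nat \<Rightarrow>\<^sub>0 nat) \<Rightarrow> int multiset"
  where "index_mset \<nu> = (\<Sum>i\<in>Poly_Mapping.keys \<nu>. replicate_mset (Poly_Mapping.lookup \<nu> i) (int i))"

lemma count_index_mset: "count (index_mset \<nu>) (int i) = Poly_Mapping.lookup \<nu> i"
  by (simp add: index_mset_def count_sum in_keys_iff)

lemma set_index_mset: "set_mset (index_mset \<nu>) = int ` Poly_Mapping.keys \<nu>"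
  by (auto simp: index_mset_def set_mset_sum in_keys_iff split: if_splits)

lemma sum_index_mset: "sum_mset (index_mset \<nu>) = int (weight \<nu>)"
proof -
  have "sum_mset (\<Sum>i\<in>K. g i) = (\<Sum>i\<in>K. sum_mset (g i))" if "finite K"
    for K and g :: "nat \<Rightarrow> int multiset"
    using that by (induction K rule: finite_induct) simp_all
  then show ?thesis by (simp add: index_mset_def weight_def mult.commute)
qed

lemma size_index_mset: "size (index_mset \<nu>) = mdeg \<nu>"
  by (simp add: index_mset_def mdeg_def)

lemma card_index_mset: "card (set_mset (index_mset \<nu>)) = num_vars \<nu>"
  by (simp add: set_index_mset card_image num_vars_def keys.rep_eq)

text \<open>Submultisets of \<open>index_mset \<nu>\<close> correspond to exponent vectors below
  \<open>\<nu>\<close>, so a proper nonempty one with sum 0 would be a smaller nonzero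
  solution.\<close>

lemma minimal_zero_sum_index_mset:
  assumes "indecomposable_solution m \<nu>"
  shows "minimal_zero_sum (int m) (index_mset \<nu>)"
  unfolding minimal_zero_sum_def
proof (intro conjI allI impI)
  have sol: "solution m \<nu>" "\<nu> \<noteq> 0" using assms by (auto simp: indecomposable_solution_def)
  then show "int m dvd sum_mset (index_mset \<nu>)"
    by (simp add: sum_index_mset solution_def cong_0_iff)
  show "index_mset \<nu> \<noteq> {#}"
    using sol(2) set_index_mset[of \<nu>] by auto
  fix A assume A: "A \<subset># index_mset \<nu>" "A \<noteq> {#}"
  define \<mu> where "\<mu> = (\<Sum>i\<in>Poly_Mapping.keys \<nu>. Poly_Mapping.single i (count A (int i)))"
  have le: "count A x \<le> count (index_mset \<nu>) x" for x
    using A(1) by (simp add: mset_subset_eq_count subset_mset.less_imp_le)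
  have lk: "Poly_Mapping.lookup \<mu> i = count A (int i)" for i
    using le[of "int i"] by (auto simp: \<mu>_def lookup_sum lookup_single when_def in_keys_iff count_index_mset)
  have "index_mset \<mu> = A"
  proof (rule multiset_eqI)
    fix x
    show "count (index_mset \<mu>) x = count A x"
    proof (cases "x \<ge> 0")
      case True
      then show ?thesis using count_index_mset[of \<mu> "nat x"] lk[of "nat x"] by simp
    next
      \<comment> \<open>Negative integers are not indices of variables.\<close>
      case False
      then have "x \<notin># index_mset \<mu>" "x \<notin># index_mset \<nu>" by (auto simp: set_index_mset)
      then show ?thesis using le[of x] by (simp add: not_in_iff)
    qed
  qed
  note \<mu> = this
  show "\<not> int m dvd sum_mset A"
  proof
    assume "int m dvd sum_mset A"
    then have "m dvd weight \<mu>" using sum_index_mset[of \<mu>] \<mu> by simp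
    moreover have "Poly_Mapping.keys \<mu> \<subseteq> Poly_Mapping.keys \<nu>"
      using le lk by (metis count_index_mset in_keys_iff le_zero_eq subsetI)
    ultimately have "solution m \<mu>" using sol by (auto simp: solution_def exponents_def cong_0_iff)
    moreover have "\<mu> \<noteq> 0" using A(2) \<mu> by (auto simp: index_mset_def)
    moreover have "\<forall>i. Poly_Mapping.lookup \<mu> i \<le> Poly_Mapping.lookup \<nu> i"
      using le lk count_index_mset by metis
    ultimately have "\<mu> = \<nu>" using assms by (auto simp: indecomposable_solution_def)
    then show False using A(1) \<mu> by simp
  qed
qed

section \<open>Fundamental invariants\<close>

lemma exceptional_monomials:
  "(X 1 * X 3 * X 4 ^ 2 :: 'k::field mpoly) =
     monomial (Poly_Mapping.single 1 1 + Poly_Mapping.single 3 1 + Poly_Mapping.single 4 2)"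
  "(X 2 ^ 2 * X 3 * X 5 :: 'k::field mpoly) =
     monomial (Poly_Mapping.single 2 2 + Poly_Mapping.single 3 1 + Poly_Mapping.single 5 1)"
  unfolding monomial_eq_single X_power by (simp_all add: X_def mult_single)

text \<open>The exception in (i) is an equivalence, so it also records that the two listed monomials
  have more than two variables. The subtraction in (iii) is taken in the integers to avoid
  truncation.\<close>

theorem corollary4:
  fixes m :: nat
    and G :: "('g, 'h) monoid_scheme"
    and \<phi> :: "'g \<Rightarrow> 'k::field mpoly \<Rightarrow> 'k mpoly"
    and \<epsilon> :: 'k and A :: 'g
    and f :: "'k mpoly" and \<nu> :: "nat \<Rightarrow>\<^sub>0 nat"
  assumes "m \<ge> 2"
    and "standard_representation m G \<phi> \<epsilon> A"
    and "fundamental_invariant m f"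
    and "f = monomial \<nu>"
  shows "(mdeg \<nu> + num_vars \<nu> = m + 1 \<longrightarrow>
            (num_vars \<nu> \<le> 2 \<longleftrightarrow> \<not> (m = 6 \<and> (f = X 1 * X 3 * X 4 ^ 2 \<or> f = X 2 ^ 2 * X 3 * X 5))))
       \<and> (m \<ge> 3 \<and> m \<noteq> 6 \<and> mdeg \<nu> + num_vars \<nu> = m + 1 \<longrightarrow>
            (\<exists>i\<in>{1..m-1}. Poly_Mapping.lookup \<nu> i \<ge> m - 2))
       \<and> (m \<ge> 7 \<and> num_vars \<nu> \<ge> 3 \<longrightarrow> int (mdeg \<nu>) \<le> int m - int (num_vars \<nu>))"
proof -
  define S where "S = index_mset \<nu>"
  have ind: "indecomposable_solution m \<nu>"
    using assms(3,4) by (auto simp: fundamental_invariant_def monomial_inject)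
  then have S: "minimal_zero_sum (int m) S" by (simp add: S_def minimal_zero_sum_index_mset)
  have keys: "Poly_Mapping.keys \<nu> \<subseteq> {1..m-1}"
    using ind by (auto simp: indecomposable_solution_def solution_def exponents_def)
  then have range: "set_mset S \<subseteq> {0<..<int m}"
    using assms(1) by (force simp: S_def set_index_mset)
  have sz: "size S = mdeg \<nu>" "card (set_mset S) = num_vars \<nu>"
    by (simp_all add: S_def size_index_mset card_index_mset)
  have cnt: "Poly_Mapping.lookup \<nu> i = count S (int i)" for i by (simp add: S_def count_index_mset)
  have "num_vars \<nu> \<le> mdeg \<nu>"
    unfolding sz[symmetric] size_multiset_overloaded_eq
    using sum_mono[of "set_mset S" "\<lambda>_. 1" "count S"] by (simp add: Suc_leI)
  have iii: "mdeg \<nu> + num_vars \<nu> \<le> m" if "m \<ge> 7" "num_vars \<nu> \<ge> 3"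
    using minimal_zero_sum_size_bound[OF S range] that sz by simp
  have exc: "m = 6 \<and> (f = X 1 * X 3 * X 4 ^ 2 \<or> f = X 2 ^ 2 * X 3 * X 5)"
    if eq: "mdeg \<nu> + num_vars \<nu> = m + 1" and nv: "num_vars \<nu> \<ge> 3"
  proof -
    \<comment> \<open>Part (iii) excludes \<open>m >= 7\<close>, while three variables need
      \<open>m >= 6\<close>.\<close>
    have "m < 7" using iii eq nv by linarith
    moreover have "2 * num_vars \<nu> \<le> m"
      using minimal_zero_sum_card_bound[OF S range] sz nv \<open>num_vars \<nu> \<le> mdeg \<nu>\<close> by simp
    ultimately have m6: "m = 6" "num_vars \<nu> = 3" "mdeg \<nu> = 4" using eq nv by auto
    then have "S = {#1, 3, 4, 4#} \<or> S = {#2, 2, 3, 5#}"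
      using minimal_zero_sum_six[of S] S range sz by simp
    then have "\<nu> = Poly_Mapping.single 1 1 + Poly_Mapping.single 3 1 + Poly_Mapping.single 4 2 \<or>
      \<nu> = Poly_Mapping.single 2 2 + Poly_Mapping.single 3 1 + Poly_Mapping.single 5 1"
    proof
      assume S: "S = {#1, 3, 4, 4#}"
      have "\<nu> = Poly_Mapping.single 1 1 + Poly_Mapping.single 3 1 + Poly_Mapping.single 4 2"
        by (rule poly_mapping_eqI) (auto simp: cnt S lookup_add lookup_single when_def)
      then show ?thesis by blast
    next
      assume S: "S = {#2, 2, 3, 5#}"
      have "\<nu> = Poly_Mapping.single 2 2 + Poly_Mapping.single 3 1 + Poly_Mapping.single 5 1"
        by (rule poly_mapping_eqI) (auto simp: cnt S lookup_add lookup_single when_def)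
      then show ?thesis by blast
    qed
    then show ?thesis using m6(1) assms(4) unfolding exceptional_monomials by blast
  qed
  have exc': "num_vars \<nu> = 3" if f: "f = X 1 * X 3 * X 4 ^ 2 \<or> f = X 2 ^ 2 * X 3 * X 5"
  proof -
    consider "\<nu> = Poly_Mapping.single 1 1 + Poly_Mapping.single 3 1 + Poly_Mapping.single 4 2"
      | "\<nu> = Poly_Mapping.single 2 2 + Poly_Mapping.single 3 1 + Poly_Mapping.single 5 1"
      using f unfolding assms(4) exceptional_monomials monomial_inject by blast
    then show ?thesis
    proof cases
      case 1
      then have "{i. Poly_Mapping.lookup \<nu> i \<noteq> 0} = {1, 3, 4}"
        by (auto simp: lookup_add lookup_single when_def)
      then show ?thesis by (simp add: num_vars_def)
    next
      case 2
      then have "{i. Poly_Mapping.lookup \<nu> i \<noteq> 0} = {2, 3, 5}"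
        by (auto simp: lookup_add lookup_single when_def)
      then show ?thesis by (simp add: num_vars_def)
    qed
  qed
  have ii: "\<exists>i\<in>{1..m-1}. Poly_Mapping.lookup \<nu> i \<ge> m - 2"
    if m: "m \<ge> 3" "m \<noteq> 6" and eq: "mdeg \<nu> + num_vars \<nu> = m + 1"
  proof -
    have "\<exists>x\<in>set_mset S. count S x \<ge> m - 2"
    proof -
      have "num_vars \<nu> \<noteq> 0"
        using S unfolding sz(2)[symmetric] by (simp add: minimal_zero_sum_def)
      \<comment> \<open>As \<open>m\<close> is not 6, three or more variables are impossible. One
        variable has exponent \<open>m\<close>; two variables have total degree
        \<open>m - 1\<close>.\<close>
      then consider "num_vars \<nu> = 1" | "num_vars \<nu> = 2" using exc eq m by linarith
      then show ?thesis
      proof cases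
        case 1
        then obtain x where "set_mset S = {x}" using sz by (metis card_1_singletonE)
        then show ?thesis using eq sz 1 by (simp add: size_multiset_overloaded_eq)
      next
        case 2
        then obtain a b where ab: "set_mset S = {a, b}" "a \<noteq> b" using sz by (metis card_2_iff)
        have "int (size S) + 1 = int m" using eq 2 sz by simp
        then show ?thesis
          using two_variables_large_count[OF S ab] range ab by auto
      qed
    qed
    then obtain i where "i \<in> Poly_Mapping.keys \<nu>" "count S (int i) \<ge> m - 2"
      by (auto simp: S_def set_index_mset)
    then show ?thesis using keys cnt by auto
  qed
  show ?thesis
  proof (intro conjI impI; (elim conjE)?)
    assume "mdeg \<nu> + num_vars \<nu> = m + 1"
    then show "num_vars \<nu> \<le> 2 \<longleftrightarrow> \<not> (m = 6 \<and> (f = X 1 * X 3 * X 4 ^ 2 \<or> f = X 2 ^ 2 * X 3 * X 5))"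
      using exc exc' by fastforce
  next
    assume "m \<ge> 7" "num_vars \<nu> \<ge> 3"
    then show "int (mdeg \<nu>) \<le> int m - int (num_vars \<nu>)" using iii by linarith
  qed (use ii in blast)
qed

end
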